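(* Let $\delta,\alpha$ be real numbers with $0<\alpha\le\delta\le 1/4$, let $A\subseteq\mathbf{F}_2^n$ with $|A|=\delta N$ where $N=2^n$, and let $\mathcal{R}_\alpha=\{r:|\widehat{A}(r)|\ge\alpha N\}$. Suppose $\Lambda\subseteq\mathbf{F}_2^n$ belongs to the family $\mathbf{\Lambda}(2\log(1/\delta))$. Then for every integer $d$ with $1\le d\le\log(1/\delta)/4$, $$|d\dot{\Lambda}\cap\mathcal{R}_\alpha|\le\Big(\frac{\delta}{\alpha}\Big)^2\Big(\frac{2^{12}\log(1/\delta)}{d}\Big)^d.$$
   Context: $\log$ denotes the logarithm to base $2$. The Fourier transform of $A$ is $\widehat{A}(\xi)=\sum_{x}A(x)e(-\xi\cdot x)$, $e(y)=e^{2\pi i y}$, for $\xi$ in the dual group of $\mathbf{F}_2^n$ (identified with $\mathbf{F}_2^n$, so that $\widehat A(r)=\sum_{x\in A}(-1)^{r\cdot x}$). A set $\Lambda=\{\lambda_1,\dots,\lambda_{|\Lambda|}\}\subseteq\mathbf{F}_2^n$ belongs to the family $\mathbf{\Lambda}(k)$ ($k$ a positive real) if whenever $\sum_i\varepsilon_i\lambda_i=0$ with $\varepsilon_i\in\{-1,0,1\}$ and $\sum_i|\varepsilon_i|\le k$, all $\varepsilon_i$ are zero. $d\dot{\Lambda}$ denotes the set of all sums of $d$ pairwise distinct elements of $\Lambda$. *)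

theory Defs
  imports "HOL-Analysis.Analysis" "HOL-Library.Z2"
begin

instance bit :: finite
proof
  have "(UNIV :: bit set) = {0, 1}"
    by auto
  then show "finite (UNIV :: bit set)"
    by (metis finite.emptyI finite.insertI)
qed

definition echar :: "real \<Rightarrow> complex" where
  "echar y = exp (2 * of_real pi * \<i> * of_real y)"

definition dot :: "bit ^ 'n \<Rightarrow> bit ^ 'n \<Rightarrow> bit" where
  "dot r x = (\<Sum>i\<in>UNIV. r $ i * x $ i)"

text \<open>
  The dual group of \<open>bit ^ 'n\<close> is identified with \<open>bit ^ 'n\<close>: the vector \<open>r\<close> is the
  homomorphism into the reals modulo 1 that sends \<open>x\<close> to the class of \<open>dual_pairing r x\<close>.
\<close>

definition dual_pairing :: "bit ^ 'n \<Rightarrow> bit ^ 'n \<Rightarrow> real" where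
  "dual_pairing r x = of_bit (dot r x) / 2"

definition fourier :: "(bit ^ 'n \<Rightarrow> complex) \<Rightarrow> bit ^ 'n \<Rightarrow> complex" where
  "fourier f r = (\<Sum>x\<in>UNIV. f x * echar (- dual_pairing r x))"

lemma echar_dual: "echar (- dual_pairing r x) = (if dot r x = 0 then 1 else -1)"
proof (cases "dot r x = 0")
  case False
  have "exp (- (complex_of_real pi * \<i>)) = -1"
    by (metis exp_minus exp_pi_i inverse_minus_eq inverse_1)
  then show ?thesis
    using False by (simp add: echar_def dual_pairing_def mult.commute)
qed (simp add: echar_def dual_pairing_def)

lemma fourier_indicator:
  "fourier (indicator A) r = (\<Sum>x\<in>A. if dot r x = 0 then 1 else -1)"
proof -
  have "fourier (indicator A) r = (\<Sum>x\<in>UNIV. if x \<in> A then if dot r x = 0 then 1 else -1 else 0)"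
    unfolding fourier_def echar_dual by (rule sum.cong) (auto simp: indicator_def)
  also have "\<dots> = (\<Sum>x\<in>A. if dot r x = 0 then 1 else -1)"
    by (subst sum.inter_restrict [symmetric]) auto
  finally show ?thesis .
qed

definition spectrum :: "(bit ^ 'n) set \<Rightarrow> real \<Rightarrow> (bit ^ 'n) set" where
  "spectrum A \<alpha> = {r. cmod (fourier (indicator A) r) \<ge> \<alpha> * 2 ^ CARD('n)}"

text \<open>
  \<open>Lambda_family k\<close> is the family \<open>\<^bold>\<Lambda>(k)\<close>. The coefficients are indexed by the elements of
  the set themselves, and \<open>of_int (\<epsilon> x) *s x\<close> is the integer multiple \<open>\<epsilon> x \<cdot> x\<close>.
\<close>

definition Lambda_family :: "real \<Rightarrow> (bit ^ 'n) set set" where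
  "Lambda_family k = {L. \<forall>\<epsilon> :: bit ^ 'n \<Rightarrow> int.
     (\<forall>x\<in>L. \<epsilon> x \<in> {-1, 0, 1}) \<longrightarrow>
     (\<Sum>x\<in>L. of_int (\<epsilon> x) *s x) = 0 \<longrightarrow>
     real_of_int (\<Sum>x\<in>L. \<bar>\<epsilon> x\<bar>) \<le> k \<longrightarrow>
     (\<forall>x\<in>L. \<epsilon> x = 0)}"

definition distinct_sums :: "nat \<Rightarrow> (bit ^ 'n) set \<Rightarrow> (bit ^ 'n) set" where
  "distinct_sums d L = {\<Sum>x\<in>S. x | S. S \<subseteq> L \<and> finite S \<and> card S = d}"

end

(* Let Q be the set to be bounded and f a sum of the characters in Q with signs chosen so that
   f correlates with A by at least alpha N |Q|. By the power mean inequality it suffices to bound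
   the 2m-th moment of f, with m = floor(log(1/delta)/d). Every character in f is a product of d
   characters from Lambda, and a relation in the expansion of f^(2m) has length at most
   2md <= 2 log(1/delta), so the moment is the same as for independent random signs. For these,
   Bonami's hypercontractive inequality gives E f^(2m) <= ((2m)^d |Q|)^m. *)
theory Submission
  imports Defs
begin

section \<open>Hypercontractivity for independent signs\<close>

text \<open>Passing from j to j + 1 multiplies the left side by (m - j)(2m - 2j - 1) / ((j + 1)(2j +
  1)) and the right side by 2m(m - j) / (j + 1), which is at least as large.\<close>

lemma binomial_even_le: "((2 * m) choose (2 * j)) \<le> (m choose j) * (2 * m) ^ j"
proof (induction j)
  case (Suc j)
  have step: "Suc k * (n choose Suc k) = (n choose k) * (n - k)" for n k :: nat
    by (metis binomial_absorb_comp binomial_absorption mult.commute)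
  \<comment> \<open>Two absorption steps, cleared of denominators. The factor 2 on both sides comes
    from 2j + 2 = 2(j + 1) and 2m - 2j = 2(m - j).\<close>
  have A: "2 * ((2 * j + 1) * (Suc j * ((2 * m) choose (2 * Suc j))))
      = 2 * (((2 * m) choose (2 * j)) * ((m - j) * (2 * m - (2 * j + 1))))"
  proof -
    have "2 * ((2 * j + 1) * (Suc j * ((2 * m) choose (2 * Suc j))))
        = (2 * j + 1) * (Suc (2 * j + 1) * ((2 * m) choose Suc (2 * j + 1)))"
      by simp
    also have "\<dots> = (Suc (2 * j) * ((2 * m) choose Suc (2 * j))) * (2 * m - (2 * j + 1))"
      unfolding step [of "2 * j + 1"] by (simp only: ac_simps Suc_eq_plus1)
    also have "\<dots> = ((2 * m) choose (2 * j)) * (2 * m - 2 * j) * (2 * m - (2 * j + 1))"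
      unfolding step by simp
    also have "2 * m - 2 * j = 2 * (m - j)"
      by simp
    finally show ?thesis
      by (simp add: ac_simps)
  qed
  have "Suc j * ((2 * m) choose (2 * Suc j)) \<le> (2 * j + 1) * (Suc j * ((2 * m) choose (2 * Suc j)))"
    by (metis le_add2 mult_le_mono1 nat_mult_1)
  also have "\<dots> = ((2 * m) choose (2 * j)) * ((m - j) * (2 * m - (2 * j + 1)))"
    using A by linarith
  also have "\<dots> \<le> ((m choose j) * (2 * m) ^ j) * ((m - j) * (2 * m))"
    by (intro mult_le_mono Suc.IH) auto
  also have "\<dots> = (m choose j) * (m - j) * (2 * m) ^ Suc j"
    by simp
  also have "\<dots> = Suc j * ((m choose Suc j) * (2 * m) ^ Suc j)"
    unfolding step [symmetric] by (simp only: mult.assoc)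
  finally show ?case
    by (metis Suc_mult_le_cancel1)
qed auto

text \<open>This is the hypercontractive inequality for a single sign. Odd powers of h cancel, and
  the remaining terms are compared one by one with the binomial expansion of the right side.\<close>

lemma two_point_inequality:
  fixes g h :: real
  shows "(g + h) ^ (2 * m) + (g - h) ^ (2 * m) \<le> 2 * (g\<^sup>2 + real (2 * m) * h\<^sup>2) ^ m"
proof -
  have even_part: "(\<Sum>k\<le>2 * n. F k) = (\<Sum>j\<le>n. F (2 * j))"
    if "\<And>k. odd k \<Longrightarrow> F k = 0" for F :: "nat \<Rightarrow> real" and n
    using that by (induction n) auto
  have "(g + h) ^ (2 * m) + (g - h) ^ (2 * m) = (h + g) ^ (2 * m) + (- h + g) ^ (2 * m)"
    by (simp add: algebra_simps)
  also have "\<dots> = (\<Sum>k\<le>2 * m. real ((2 * m) choose k) * (h ^ k + (- h) ^ k) * g ^ (2 * m - k))"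
    unfolding binomial_ring by (simp add: sum.distrib [symmetric] algebra_simps)
  also have "\<dots> = (\<Sum>j\<le>m. real ((2 * m) choose (2 * j)) * (2 * h ^ (2 * j)) * g ^ (2 * m - 2 * j))"
    by (subst even_part) auto
  also have "\<dots> \<le> (\<Sum>j\<le>m. real ((m choose j) * (2 * m) ^ j) * (2 * h ^ (2 * j)) * g ^ (2 * m - 2 * j))"
  proof (intro sum_mono mult_right_mono)
    fix j
    show "real ((2 * m) choose (2 * j)) \<le> real ((m choose j) * (2 * m) ^ j)"
      using binomial_even_le by (rule of_nat_mono)
  qed (auto simp flip: right_diff_distrib')
  also have "\<dots> = 2 * (\<Sum>j\<le>m. real (m choose j) * (real (2 * m) * h\<^sup>2) ^ j * (g\<^sup>2) ^ (m - j))"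
    unfolding sum_distrib_left
    by (intro sum.cong)
       (auto simp: power_mult_distrib power_mult [symmetric] diff_mult_distrib2 algebra_simps)
  also have "\<dots> = 2 * (real (2 * m) * h\<^sup>2 + g\<^sup>2) ^ m"
    unfolding binomial_ring ..
  finally show ?thesis
    by (simp add: add.commute)
qed

text \<open>The triangle inequality in L^m, stated for upper bounds U and V of the norms so that no
  m-th roots occur; c is the normalising factor of the measure.\<close>

lemma Minkowski_sum_power:
  fixes u v :: "'a \<Rightarrow> real"
  assumes "finite Y" and m: "m > 0" and nn: "\<And>y. y \<in> Y \<Longrightarrow> u y \<ge> 0" "\<And>y. y \<in> Y \<Longrightarrow> v y \<ge> 0"
    and UV: "U \<ge> 0" "V \<ge> 0"
    and u: "(\<Sum>y\<in>Y. u y ^ m) \<le> c * U ^ m" and v: "(\<Sum>y\<in>Y. v y ^ m) \<le> c * V ^ m"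
  shows "(\<Sum>y\<in>Y. (u y + v y) ^ m) \<le> c * (U + V) ^ m"
proof -
  \<comment> \<open>The main case divides by U and V. A zero bound forces the function to vanish on
    Y, which leaves the bound for the other one.\<close>
  have zero: "\<forall>y\<in>Y. w y = 0"
    if "(\<Sum>y\<in>Y. w y ^ m) \<le> c * 0 ^ m" and "\<And>y. y \<in> Y \<Longrightarrow> w y \<ge> 0" for w :: "'a \<Rightarrow> real"
  proof -
    have "(\<Sum>y\<in>Y. w y ^ m) = 0"
      using that m by (intro antisym sum_nonneg) (auto simp: zero_power)
    then show ?thesis
      using that \<open>finite Y\<close> m by (subst (asm) sum_nonneg_eq_0_iff) auto
  qed
  consider "U = 0" | "V = 0" | "U > 0" "V > 0"
    using UV by linarith
  then show ?thesis
  proof cases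
    case 1
    then show ?thesis using zero [of u] u v nn by simp
  next
    case 2
    then show ?thesis using zero [of v] u v nn by simp
  next
    case 3
    \<comment> \<open>With these weights (u + v) / (U + V) is a convex combination of u / U and v /
      V, so convexity of the m-th power applies.\<close>
    define t where "t = V / (U + V)"
    have t: "0 \<le> t" "t \<le> 1" "1 - t = U / (U + V)"
      using 3 by (auto simp: t_def field_simps)
    have cvx: "convex_on {0..} (\<lambda>x::real. x ^ m)"
      by (cases "even m") (auto intro: convex_power_odd convex_on_subset [OF convex_power_even])
    have pt: "(u y + v y) ^ m \<le> (U + V) ^ m * ((1 - t) * (u y ^ m / U ^ m) + t * (v y ^ m / V ^ m))"
      if "y \<in> Y" for y
    proof -
      have "(1 - t) * (u y / U) + t * (v y / V) = (u y + v y) / (U + V)"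
        using 3 unfolding t(3) by (simp add: t_def add_divide_distrib)
      then have "u y + v y = (U + V) * ((1 - t) * (u y / U) + t * (v y / V))"
        using 3 by simp
      then have "(u y + v y) ^ m = (U + V) ^ m * ((1 - t) * (u y / U) + t * (v y / V)) ^ m"
        by (simp add: power_mult_distrib)
      also have "\<dots> \<le> (U + V) ^ m * ((1 - t) * (u y / U) ^ m + t * (v y / V) ^ m)"
        using convex_onD [OF cvx t(1,2), of "u y / U" "v y / V"] nn that 3
        by (intro mult_left_mono) auto
      finally show ?thesis
        by (simp add: power_divide)
    qed
    have "(\<Sum>y\<in>Y. (u y + v y) ^ m)
        \<le> (\<Sum>y\<in>Y. (U + V) ^ m * ((1 - t) * (u y ^ m / U ^ m) + t * (v y ^ m / V ^ m)))"
      by (rule sum_mono) (rule pt)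
    also have "\<dots> = (U + V) ^ m * ((1 - t) * ((\<Sum>y\<in>Y. u y ^ m) / U ^ m) + t * ((\<Sum>y\<in>Y. v y ^ m) / V ^ m))"
      unfolding sum_divide_distrib sum_distrib_left sum.distrib [symmetric] ..
    also have "\<dots> \<le> (U + V) ^ m * ((1 - t) * c + t * c)"
      using 3 u v t(1,2) by (intro mult_left_mono add_mono) (auto simp: field_simps)
    finally show ?thesis
      by (simp add: algebra_simps)
  qed
qed

text \<open>A set Y encodes the sign pattern that is -1 exactly on Y, so the sum over
  \<open>Pow X\<close> is 2^|X| times the mean over independent signs. The induction singles out one
  sign, that of t, and writes the polynomial as g plus or minus h with g and h free of t.\<close>

lemma Bonami_even_moment:
  fixes a :: "'a set \<Rightarrow> real"
  assumes "finite X" and m: "m > 0"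
  shows "(\<Sum>Y\<in>Pow X. (\<Sum>S\<in>Pow X. a S * (\<Prod>s\<in>S. if s \<in> Y then -1 else 1)) ^ (2 * m))
    \<le> 2 ^ card X * (\<Sum>S\<in>Pow X. real (2 * m) ^ card S * (a S)\<^sup>2) ^ m"
  using \<open>finite X\<close>
proof (induction X arbitrary: a)
  case empty
  show ?case by (simp add: power_mult)
next
  case (insert t X)
  define w where "w Y S = (\<Prod>s\<in>S. if s \<in> Y then -1 else 1 :: real)" for Y S :: "'a set"
  define g where "g Y = (\<Sum>S\<in>Pow X. a S * w Y S)" for Y
  define h where "h Y = (\<Sum>S\<in>Pow X. a (insert t S) * w Y S)" for Y
  define G where "G = (\<Sum>S\<in>Pow X. real (2 * m) ^ card S * (a S)\<^sup>2)"
  define H where "H = (\<Sum>S\<in>Pow X. real (2 * m) ^ card S * (a (insert t S))\<^sup>2)"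
  have split: "(\<Sum>S\<in>Pow (insert t X). F S) = (\<Sum>S\<in>Pow X. F S + F (insert t S))" for F :: "'a set \<Rightarrow> real"
  proof -
    have "inj_on (insert t) (Pow X)"
      using insert.hyps by (auto simp: inj_on_def)
    then show ?thesis
      using insert.hyps unfolding Pow_insert
      by (subst sum.union_disjoint) (auto simp: sum.reindex sum.distrib)
  qed
  have w1: "w Y (insert t S) = (if t \<in> Y then -1 else 1) * w Y S" if "S \<subseteq> X" for S Y
    using that insert.hyps by (subst w_def, subst prod.insert) (auto simp: w_def intro: finite_subset)
  have w2: "w (insert t Y) S = w Y S" if "S \<subseteq> X" for S Y
    using that insert.hyps unfolding w_def by (intro prod.cong) auto
  \<comment> \<open>The splitting acts on the patterns as well as on the index sets: Y gives t the
    sign +1, hence g + h, and \<open>insert t Y\<close> gives it -1, hence g - h.\<close>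
  have "(\<Sum>Y\<in>Pow (insert t X). (\<Sum>S\<in>Pow (insert t X). a S * w Y S) ^ (2 * m))
      = (\<Sum>Y\<in>Pow X. (g Y + h Y) ^ (2 * m) + (g Y - h Y) ^ (2 * m))"
    unfolding split
  proof (intro sum.cong refl arg_cong2 [where f = "(+)"] arg_cong [where f = "\<lambda>x. x ^ (2 * m)"])
    fix Y assume "Y \<in> Pow X"
    with insert.hyps have "t \<notin> Y" by auto
    then show "(\<Sum>S\<in>Pow X. a S * w Y S + a (insert t S) * w Y (insert t S)) = g Y + h Y"
      unfolding g_def h_def sum.distrib [symmetric] by (intro sum.cong) (auto simp: w1)
    show "(\<Sum>S\<in>Pow X. a S * w (insert t Y) S + a (insert t S) * w (insert t Y) (insert t S)) = g Y - h Y"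
      unfolding g_def h_def sum_subtractf [symmetric] by (intro sum.cong) (auto simp: w1 w2)
  qed
  also have "\<dots> \<le> (\<Sum>Y\<in>Pow X. 2 * ((g Y)\<^sup>2 + real (2 * m) * (h Y)\<^sup>2) ^ m)"
    by (intro sum_mono two_point_inequality)
  also have "\<dots> = 2 * (\<Sum>Y\<in>Pow X. ((g Y)\<^sup>2 + real (2 * m) * (h Y)\<^sup>2) ^ m)"
    by (simp only: sum_distrib_left)
  \<comment> \<open>Minkowski for g^2 and 2m h^2, with the induction hypothesis applied to g and to
    h. The factor 2m in front of H is the extra weight of index sets containing t.\<close>
  also have "\<dots> \<le> 2 * (2 ^ card X * (G + real (2 * m) * H) ^ m)"
  proof (intro mult_left_mono Minkowski_sum_power m)
    show "(\<Sum>Y\<in>Pow X. ((g Y)\<^sup>2) ^ m) \<le> 2 ^ card X * G ^ m"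
      using insert.IH [of a] unfolding w_def [symmetric] g_def [symmetric] G_def [symmetric]
      by (simp add: power_mult)
    have "(\<Sum>Y\<in>Pow X. h Y ^ (2 * m)) \<le> 2 ^ card X * H ^ m"
      using insert.IH [of "\<lambda>S. a (insert t S)"]
      unfolding w_def [symmetric] h_def [symmetric] H_def [symmetric] .
    then have "real (2 * m) ^ m * (\<Sum>Y\<in>Pow X. h Y ^ (2 * m)) \<le> real (2 * m) ^ m * (2 ^ card X * H ^ m)"
      by (rule mult_left_mono) simp
    then show "(\<Sum>Y\<in>Pow X. (real (2 * m) * (h Y)\<^sup>2) ^ m) \<le> 2 ^ card X * (real (2 * m) * H) ^ m"
      unfolding power_mult_distrib power_mult [symmetric] sum_distrib_left [symmetric]
      by (simp only: ac_simps)
  qed (use insert.hyps in \<open>auto simp: G_def H_def intro!: sum_nonneg mult_nonneg_nonneg\<close>)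
  also have "G + real (2 * m) * H = (\<Sum>S\<in>Pow (insert t X). real (2 * m) ^ card S * (a S)\<^sup>2)"
  proof -
    have "card (insert t S) = Suc (card S)" if "S \<subseteq> X" for S
      using that insert.hyps by (auto intro: finite_subset card_insert_disjoint)
    then show ?thesis
      unfolding split G_def H_def sum_distrib_left sum.distrib [symmetric]
      by (intro sum.cong) (auto simp: algebra_simps)
  qed
  finally show ?case
    using insert.hyps unfolding w_def by simp
qed

section \<open>Transfer of moments from independent signs to dissociated systems\<close>

lemma sum_eq_0_if_sign_reversing_involution:
  fixes f :: "'a \<Rightarrow> real"
  assumes "\<And>x. x \<in> X \<Longrightarrow> \<phi> x \<in> X" "\<And>x. x \<in> X \<Longrightarrow> \<phi> (\<phi> x) = x" "\<And>x. x \<in> X \<Longrightarrow> f (\<phi> x) = - f x"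
  shows "(\<Sum>x\<in>X. f x) = 0"
proof -
  have "(\<Sum>x\<in>X. f x) = (\<Sum>x\<in>X. - f x)"
    by (rule sum.reindex_bij_witness [of _ \<phi> \<phi>]) (use assms in auto)
  then show ?thesis
    by (simp add: sum_negf)
qed

text \<open>The common factors occur squared and drop out. Hence a product of multilinear monomials
  in signs is again a multilinear monomial.\<close>

lemma prod_sign_sym_diff:
  fixes \<sigma> :: "'a \<Rightarrow> real"
  assumes fin: "finite S" "finite T" and sq: "\<And>s. s \<in> S \<union> T \<Longrightarrow> \<sigma> s * \<sigma> s = 1"
  shows "(\<Prod>s\<in>S. \<sigma> s) * (\<Prod>s\<in>T. \<sigma> s) = (\<Prod>s\<in>sym_diff S T. \<sigma> s)"
proof -
  have split: "(\<Prod>s\<in>S. \<sigma> s) = (\<Prod>s\<in>S \<inter> T. \<sigma> s) * (\<Prod>s\<in>S - T. \<sigma> s)"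
    "(\<Prod>s\<in>T. \<sigma> s) = (\<Prod>s\<in>S \<inter> T. \<sigma> s) * (\<Prod>s\<in>T - S. \<sigma> s)"
    using prod.Int_Diff [OF fin(1), of \<sigma> T] prod.Int_Diff [OF fin(2), of \<sigma> S] by (simp_all add: Int_commute)
  have "(\<Prod>s\<in>S \<inter> T. \<sigma> s) * (\<Prod>s\<in>S \<inter> T. \<sigma> s) = 1"
    unfolding prod.distrib [symmetric] by (rule prod.neutral) (use sq in auto)
  moreover have "(\<Prod>s\<in>sym_diff S T. \<sigma> s) = (\<Prod>s\<in>S - T. \<sigma> s) * (\<Prod>s\<in>T - S. \<sigma> s)"
    using fin by (intro prod.union_disjoint) auto
  ultimately show ?thesis
    unfolding split by (simp add: algebra_simps)
qed

text \<open>
  Since \<open>b\<close> is chosen before \<open>\<sigma>\<close>, moments of the same polynomial in different systems of signs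
  can be compared through \<open>b {}\<close>.
\<close>

lemma sign_polynomial_power:
  fixes a :: "'a set \<Rightarrow> real"
  assumes "finite L" and supp: "\<forall>S. S \<subseteq> L \<longrightarrow> d < card S \<longrightarrow> a S = 0"
  shows "\<exists>b. (\<forall>U. U \<subseteq> L \<longrightarrow> k * d < card U \<longrightarrow> b U = 0) \<and>
    (\<forall>\<sigma>. (\<forall>s\<in>L. \<sigma> s * \<sigma> s = 1) \<longrightarrow>
      (\<Sum>S\<in>Pow L. a S * (\<Prod>s\<in>S. \<sigma> s)) ^ k = (\<Sum>U\<in>Pow L. b U * (\<Prod>s\<in>U. \<sigma> s)))"
proof (induction k)
  case 0
  have "(\<Sum>U\<in>Pow L. (if U = {} then 1 else 0) * (\<Prod>s\<in>U. \<sigma> s)) = (1 :: real)" for \<sigma>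
  proof -
    have "(\<Sum>U\<in>Pow L. (if U = {} then 1 else 0) * (\<Prod>s\<in>U. \<sigma> s))
        = (\<Sum>U\<in>Pow L. if U = {} then 1 else 0 :: real)"
      by (intro sum.cong) auto
    then show ?thesis
      using \<open>finite L\<close> by simp
  qed
  then show ?case
    by (intro exI [of _ "\<lambda>U. if U = {} then 1 else 0"]) auto
next
  case (Suc k)
  then obtain b where b0: "\<And>U. U \<subseteq> L \<Longrightarrow> k * d < card U \<Longrightarrow> b U = 0"
    and b: "\<And>\<sigma>. (\<forall>s\<in>L. \<sigma> s * \<sigma> s = 1) \<Longrightarrow>
      (\<Sum>S\<in>Pow L. a S * (\<Prod>s\<in>S. \<sigma> s)) ^ k = (\<Sum>U\<in>Pow L. b U * (\<Prod>s\<in>U. \<sigma> s))"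
    by blast
  show ?case
  \<comment> \<open>The monomial of U arises as the monomial of S times that of
    \<open>sym_diff S U\<close>, so the new coefficients are a convolution with respect to symmetric
    difference.\<close>
  proof (intro exI [of _ "\<lambda>U. \<Sum>S\<in>Pow L. a S * b (sym_diff S U)"] conjI allI impI)
    fix U assume U: "U \<subseteq> L" "Suc k * d < card U"
    show "(\<Sum>S\<in>Pow L. a S * b (sym_diff S U)) = 0"
    proof (rule sum.neutral, rule ballI)
      fix S assume S: "S \<in> Pow L"
      then have fin: "finite S" "finite U"
        using U \<open>finite L\<close> by (auto intro: finite_subset)
      \<comment> \<open>If U has more than (k + 1)d elements, then S has more than d or
        \<open>sym_diff S U\<close> more than kd, so one of the two coefficients vanishes.\<close>
      have "card U \<le> card (S \<union> sym_diff S U)"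
        using fin by (intro card_mono) auto
      also have "\<dots> \<le> card S + card (sym_diff S U)"
        by (rule card_Un_le)
      finally have "d < card S \<or> k * d < card (sym_diff S U)"
        using U(2) by auto
      moreover have "sym_diff S U \<subseteq> L"
        using S U by auto
      ultimately show "a S * b (sym_diff S U) = 0"
        using supp [rule_format, of S] b0 [of "sym_diff S U"] S by auto
    qed
  next
    fix \<sigma> :: "'a \<Rightarrow> real" assume sq: "\<forall>s\<in>L. \<sigma> s * \<sigma> s = 1"
    have inv: "sym_diff S (sym_diff S U) = U" for S U :: "'a set"
      by auto
    have "(\<Sum>S\<in>Pow L. a S * (\<Prod>s\<in>S. \<sigma> s)) ^ Suc k
        = (\<Sum>S\<in>Pow L. \<Sum>U\<in>Pow L. (a S * (\<Prod>s\<in>S. \<sigma> s)) * (b U * (\<Prod>s\<in>U. \<sigma> s)))"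
      unfolding power_Suc b [OF sq] by (rule sum_product)
    also have "\<dots> = (\<Sum>S\<in>Pow L. \<Sum>U\<in>Pow L. a S * b U * (\<Prod>s\<in>sym_diff S U. \<sigma> s))"
    proof (intro sum.cong refl)
      fix S U assume SU: "S \<in> Pow L" "U \<in> Pow L"
      then have "(\<Prod>s\<in>S. \<sigma> s) * (\<Prod>s\<in>U. \<sigma> s) = (\<Prod>s\<in>sym_diff S U. \<sigma> s)"
        using sq \<open>finite L\<close> by (intro prod_sign_sym_diff) (auto intro: finite_subset)
      then show "(a S * (\<Prod>s\<in>S. \<sigma> s)) * (b U * (\<Prod>s\<in>U. \<sigma> s)) = a S * b U * (\<Prod>s\<in>sym_diff S U. \<sigma> s)"
        by (metis (no_types, lifting) mult.assoc mult.left_commute)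
    qed
    also have "\<dots> = (\<Sum>S\<in>Pow L. \<Sum>U\<in>Pow L. a S * b (sym_diff S U) * (\<Prod>s\<in>U. \<sigma> s))"
    proof (rule sum.cong [OF refl])
      fix S assume "S \<in> Pow L"
      then show "(\<Sum>U\<in>Pow L. a S * b U * (\<Prod>s\<in>sym_diff S U. \<sigma> s))
          = (\<Sum>U\<in>Pow L. a S * b (sym_diff S U) * (\<Prod>s\<in>U. \<sigma> s))"
        by (intro sum.reindex_bij_witness [of _ "sym_diff S" "sym_diff S"]) (auto simp: inv)
    qed
    also have "\<dots> = (\<Sum>U\<in>Pow L. \<Sum>S\<in>Pow L. a S * b (sym_diff S U) * (\<Prod>s\<in>U. \<sigma> s))"
      by (rule sum.swap)
    finally show "(\<Sum>S\<in>Pow L. a S * (\<Prod>s\<in>S. \<sigma> s)) ^ Suc k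
        = (\<Sum>U\<in>Pow L. (\<Sum>S\<in>Pow L. a S * b (sym_diff S U)) * (\<Prod>s\<in>U. \<sigma> s))"
      by (simp only: sum_distrib_right)
  qed
qed

text \<open>The 2m-th power has degree at most 2md, and nonconstant monomials up to that degree have
  mean zero both here and for independent signs. Both means therefore equal the constant coefficient
  \<open>b {}\<close>, which Bonami's inequality bounds.\<close>

lemma dissociated_even_moment:
  fixes a :: "'a set \<Rightarrow> real" and \<sigma> :: "'b \<Rightarrow> 'a \<Rightarrow> real"
  assumes fin: "finite L" and m: "m > 0"
    and supp: "\<And>S. S \<subseteq> L \<Longrightarrow> d < card S \<Longrightarrow> a S = 0"
    and sq: "\<And>x s. x \<in> X \<Longrightarrow> s \<in> L \<Longrightarrow> \<sigma> x s * \<sigma> x s = 1"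
    and orth: "\<And>S. S \<subseteq> L \<Longrightarrow> S \<noteq> {} \<Longrightarrow> card S \<le> 2 * m * d \<Longrightarrow> (\<Sum>x\<in>X. \<Prod>s\<in>S. \<sigma> x s) = 0"
  shows "(\<Sum>x\<in>X. (\<Sum>S\<in>Pow L. a S * (\<Prod>s\<in>S. \<sigma> x s)) ^ (2 * m))
    \<le> card X * (\<Sum>S\<in>Pow L. real (2 * m) ^ card S * (a S)\<^sup>2) ^ m"
proof -
  have "\<forall>S. S \<subseteq> L \<longrightarrow> d < card S \<longrightarrow> a S = 0"
    using supp by blast
  from sign_polynomial_power [OF fin this, of "2 * m"]
  obtain b where b0: "\<forall>U. U \<subseteq> L \<longrightarrow> 2 * m * d < card U \<longrightarrow> b U = 0"
    and "\<forall>\<sigma>. (\<forall>s\<in>L. \<sigma> s * \<sigma> s = 1) \<longrightarrow>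
      (\<Sum>S\<in>Pow L. a S * (\<Prod>s\<in>S. \<sigma> s)) ^ (2 * m) = (\<Sum>U\<in>Pow L. b U * (\<Prod>s\<in>U. \<sigma> s))"
    by (elim exE conjE)
  note b = this(2) [THEN spec, THEN mp, OF ballI]
  \<comment> \<open>Here \<open>I U\<close> stands for the sum of the monomial of U over a system of
    signs, and c for the number of points of that system. Only the empty monomial survives.\<close>
  have mean_b: "(\<Sum>U\<in>Pow L. b U * I U) = c * b {}"
    if "I {} = c" "\<And>U. U \<subseteq> L \<Longrightarrow> U \<noteq> {} \<Longrightarrow> card U \<le> 2 * m * d \<Longrightarrow> I U = 0" for I :: "'a set \<Rightarrow> real" and c
  proof -
    have "(\<Sum>U\<in>Pow L. b U * I U) = (\<Sum>U\<in>{{}}. b U * I U)"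
      using fin that(2) b0 by (intro sum.mono_neutral_right) (auto simp: not_le [symmetric])
    then show ?thesis using that(1) by simp
  qed
  have "(\<Sum>x\<in>X. (\<Sum>S\<in>Pow L. a S * (\<Prod>s\<in>S. \<sigma> x s)) ^ (2 * m))
      = (\<Sum>x\<in>X. \<Sum>U\<in>Pow L. b U * (\<Prod>s\<in>U. \<sigma> x s))"
    by (intro sum.cong refl b sq)
  also have "\<dots> = (\<Sum>U\<in>Pow L. b U * (\<Sum>x\<in>X. \<Prod>s\<in>U. \<sigma> x s))"
    by (subst sum.swap) (simp only: sum_distrib_left)
  also have "\<dots> = card X * b {}"
    by (rule mean_b) (use orth in auto)
  finally have lhs: "(\<Sum>x\<in>X. (\<Sum>S\<in>Pow L. a S * (\<Prod>s\<in>S. \<sigma> x s)) ^ (2 * m)) = card X * b {}" .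
  define \<tau> :: "'a set \<Rightarrow> 'a \<Rightarrow> real" where "\<tau> Y s = (if s \<in> Y then -1 else 1)" for Y s
  have "(\<Sum>Y\<in>Pow L. (\<Sum>S\<in>Pow L. a S * (\<Prod>s\<in>S. \<tau> Y s)) ^ (2 * m))
      = (\<Sum>Y\<in>Pow L. \<Sum>U\<in>Pow L. b U * (\<Prod>s\<in>U. \<tau> Y s))"
    by (intro sum.cong refl b) (auto simp: \<tau>_def)
  also have "\<dots> = (\<Sum>U\<in>Pow L. b U * (\<Sum>Y\<in>Pow L. \<Prod>s\<in>U. \<tau> Y s))"
    by (subst sum.swap) (simp only: sum_distrib_left)
  also have "\<dots> = 2 ^ card L * b {}"
  proof (rule mean_b)
    fix U assume U: "U \<subseteq> L" "U \<noteq> {}"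
    then obtain t where t: "t \<in> U" "t \<in> L" and finU: "finite U"
      using fin by (auto intro: finite_subset)
    show "(\<Sum>Y\<in>Pow L. \<Prod>s\<in>U. \<tau> Y s) = 0"
    \<comment> \<open>Toggling t in Y changes the sign of exactly one factor of the
      monomial.\<close>
    proof (rule sum_eq_0_if_sign_reversing_involution [where \<phi> = "sym_diff {t}"])
      fix Y
      have "(\<Prod>s\<in>U - {t}. \<tau> (sym_diff {t} Y) s) = (\<Prod>s\<in>U - {t}. \<tau> Y s)"
        by (intro prod.cong) (auto simp: \<tau>_def)
      moreover have "\<tau> (sym_diff {t} Y) t = - \<tau> Y t"
        by (auto simp: \<tau>_def)
      ultimately show "(\<Prod>s\<in>U. \<tau> (sym_diff {t} Y) s) = - (\<Prod>s\<in>U. \<tau> Y s)"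
        unfolding prod.remove [OF finU t(1)] by simp
    qed (use t in auto)
  qed (simp add: card_Pow fin)
  finally have "2 ^ card L * b {} \<le> 2 ^ card L * (\<Sum>S\<in>Pow L. real (2 * m) ^ card S * (a S)\<^sup>2) ^ m"
    using Bonami_even_moment [OF fin m, of a] unfolding \<tau>_def by simp
  then have "b {} \<le> (\<Sum>S\<in>Pow L. real (2 * m) ^ card S * (a S)\<^sup>2) ^ m"
    by simp
  then show ?thesis
    unfolding lhs by (rule mult_left_mono) simp
qed

section \<open>Power means, Walsh characters and relations in dissociated sets\<close>

lemma power_mean_even:
  fixes f :: "'a \<Rightarrow> real"
  assumes "finite A" "A \<noteq> {}"
  shows "card A * (\<Sum>x\<in>A. f x) ^ (2 * m) \<le> card A ^ (2 * m) * (\<Sum>x\<in>A. f x ^ (2 * m))"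
proof -
  have "(\<Sum>x\<in>A. (1 / card A) *\<^sub>R f x) ^ (2 * m) \<le> (\<Sum>x\<in>A. (1 / card A) * f x ^ (2 * m))"
    using assms convex_power_even [of "2 * m"]
    by (intro convex_on_sum [where C = UNIV and f = "\<lambda>x. x ^ (2 * m)"]) auto
  then have "((\<Sum>x\<in>A. f x) / card A) ^ (2 * m) \<le> (\<Sum>x\<in>A. f x ^ (2 * m)) / card A"
    by (simp add: sum_divide_distrib)
  then show ?thesis
    using assms by (simp add: power_divide field_simps card_gt_0_iff)
qed

text \<open>The real form of the character, with the point first: \<open>walsh x\<close> is then an
  assignment of signs to frequencies, as the moment bound expects.\<close>

definition walsh :: "bit ^ 'n \<Rightarrow> bit ^ 'n \<Rightarrow> real" where
  "walsh x r = (if dot r x = 0 then 1 else -1)"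

lemma walsh_square: "walsh x r * walsh x r = 1"
  by (simp add: walsh_def)

lemma dot_commute: "dot r x = dot x r"
  unfolding dot_def by (intro sum.cong mult.commute) simp

lemma walsh_add: "walsh x (r + s) = walsh x r * walsh x s"
proof -
  have "dot (r + s) x = dot r x + dot s x"
    by (simp add: dot_def distrib_right sum.distrib del: add_bit_eq_xor mult_bit_eq_and)
  then show ?thesis
    by (cases "dot r x"; cases "dot s x") (simp_all add: walsh_def)
qed

lemma walsh_sum: "walsh x (\<Sum>s\<in>S. s) = (\<Prod>s\<in>S. walsh x s)"
proof (induction S rule: infinite_finite_induct)
  case (insert s S)
  then show ?case by (simp add: walsh_add)
qed (simp_all add: walsh_def dot_def)

text \<open>Translation by a unit vector in a coordinate where r is nonzero is an involution that
  reverses the sign of the character.\<close>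

lemma sum_walsh_eq_0:
  fixes r :: "bit ^ 'n"
  assumes "r \<noteq> 0"
  shows "(\<Sum>x\<in>UNIV. walsh x r) = 0"
proof -
  obtain i where i: "r $ i \<noteq> 0"
    using assms by (auto simp: vec_eq_iff)
  define e :: "bit ^ 'n" where "e = axis i 1"
  have "dot r e = (\<Sum>j\<in>UNIV. if j = i then r $ j else 0)"
    unfolding dot_def e_def axis_def by (intro sum.cong) auto
  then have "walsh e r = -1"
    using i by (simp add: walsh_def)
  moreover have "walsh (x + e) r = walsh x r * walsh e r" for x
    using walsh_add [of r x e] by (simp add: walsh_def dot_commute)
  moreover have "e + e = 0"
    by (simp add: vec_eq_iff del: add_bit_eq_xor)
  ultimately show ?thesis
    by (intro sum_eq_0_if_sign_reversing_involution [where \<phi> = "\<lambda>x. x + e"]) (auto simp: add.assoc)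
qed

lemma cmod_fourier_indicator: "cmod (fourier (indicator A) r) = \<bar>\<Sum>x\<in>A. walsh x r\<bar>"
proof -
  have "fourier (indicator A) r = of_real (\<Sum>x\<in>A. walsh x r)"
    unfolding fourier_indicator of_real_sum by (intro sum.cong) (auto simp: walsh_def)
  then show ?thesis
    by (simp only: norm_of_real)
qed

text \<open>A vanishing sum over S would be a relation with coefficients the indicator of S, of
  length |S|.\<close>

lemma Lambda_family_sum_neq_0:
  fixes S \<Lambda> :: "(bit ^ 'n) set"
  assumes "\<Lambda> \<in> Lambda_family k" "S \<subseteq> \<Lambda>" "S \<noteq> {}" "real (card S) \<le> k"
  shows "(\<Sum>x\<in>S. x) \<noteq> 0"
proof
  assume zero: "(\<Sum>x\<in>S. x) = 0"
  define \<epsilon> :: "bit ^ 'n \<Rightarrow> int" where "\<epsilon> = indicator S"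
  have "(\<Sum>x\<in>\<Lambda>. of_int (\<epsilon> x) *s x) = (\<Sum>x\<in>\<Lambda>. if x \<in> S then x else 0)"
    by (intro sum.cong) (auto simp: \<epsilon>_def)
  also have "\<dots> = 0"
    using assms(2) zero by (simp add: sum.If_cases Int_absorb1)
  finally have "(\<Sum>x\<in>\<Lambda>. of_int (\<epsilon> x) *s x) = 0" .
  moreover have "(\<Sum>x\<in>\<Lambda>. \<bar>\<epsilon> x\<bar>) = card S"
    using assms(2) by (simp add: \<epsilon>_def indicator_def sum.If_cases Int_absorb1 if_distrib)
  moreover have "\<epsilon> x \<in> {-1, 0, 1}" for x
    by (simp add: \<epsilon>_def indicator_def)
  moreover have "(\<forall>x\<in>\<Lambda>. \<epsilon> x \<in> {-1, 0, 1}) \<longrightarrow> (\<Sum>x\<in>\<Lambda>. of_int (\<epsilon> x) *s x) = 0 \<longrightarrow>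
      real_of_int (\<Sum>x\<in>\<Lambda>. \<bar>\<epsilon> x\<bar>) \<le> k \<longrightarrow> (\<forall>x\<in>\<Lambda>. \<epsilon> x = 0)"
    using assms(1) unfolding Lambda_family_def by blast
  ultimately have "\<forall>x\<in>\<Lambda>. \<epsilon> x = 0"
    using assms(4) by (metis of_int_of_nat_eq)
  then show False
    using assms(2,3) by (auto simp: \<epsilon>_def indicator_def split: if_splits)
qed

section \<open>The bound for the large spectrum\<close>

text \<open>The moment argument for a free exponent 2m. In root form it says |Q| \<le>
  \<delta>^(-1/m) (\<delta>/\<alpha>)^2 (2m)^d; the choice of m is left to the theorem.\<close>

lemma card_distinct_sums_spectrum_power_le:
  fixes \<delta> \<alpha> :: real and A \<Lambda> :: "(bit ^ 'n) set"
  assumes \<alpha>: "0 < \<alpha>" and \<delta>: "0 < \<delta>" and card_A: "real (card A) = \<delta> * 2 ^ CARD('n)"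
    and \<Lambda>: "\<Lambda> \<in> Lambda_family (real (2 * m * d))" and m: "m > 0"
  defines "Q \<equiv> distinct_sums d \<Lambda> \<inter> spectrum A \<alpha>"
  shows "\<delta> * real (card Q) ^ m \<le> ((\<delta> / \<alpha>)\<^sup>2 * real (2 * m) ^ d) ^ m"
proof (cases "Q = {}")
  case True
  then show ?thesis using m by (simp add: zero_power)
next
  case False
  define N :: real where "N = 2 ^ CARD('n)"
  define q where "q = real (card Q)"
  have q: "q > 0" using False by (simp add: q_def card_gt_0_iff)
  have N: "N > 0" by (simp add: N_def)
  have cardU: "real CARD(bit ^ 'n) = N"
  proof -
    have "CARD(bit) = 2"
    proof -
      have "(UNIV :: bit set) = {0, 1}" by auto
      then show ?thesis by (metis card_2_iff zero_neq_one)
    qed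
    then show ?thesis by (simp add: N_def)
  qed
  have "\<forall>r\<in>Q. \<exists>S. S \<subseteq> \<Lambda> \<and> card S = d \<and> (\<Sum>x\<in>S. x) = r"
    unfolding Q_def distinct_sums_def by auto
  \<comment> \<open>One representing d-subset is fixed for each r. The sum over \<open>T r\<close>
    recovers r, so T is injective.\<close>
  then obtain T where T: "\<And>r. r \<in> Q \<Longrightarrow> T r \<subseteq> \<Lambda>" "\<And>r. r \<in> Q \<Longrightarrow> card (T r) = d"
    "\<And>r. r \<in> Q \<Longrightarrow> (\<Sum>x\<in>T r. x) = r"
    by metis
  have inj: "inj_on T Q"
    using T(3) by (metis inj_onI)
  \<comment> \<open>The sign that aligns the contribution of r to the sum of f over A, making it the
    absolute value of the Fourier coefficient.\<close>
  define c where "c r = sgn (\<Sum>x\<in>A. walsh x r)" for r :: "bit ^ 'n"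
  \<comment> \<open>These coefficients present f as a homogeneous polynomial of degree d in the
    signs \<open>walsh x s\<close> with s in \<Lambda>.\<close>
  define a where "a S = (if S \<in> T ` Q then c (\<Sum>x\<in>S. x) else 0)" for S
  define f where "f x = (\<Sum>S\<in>Pow \<Lambda>. a S * (\<Prod>s\<in>S. walsh x s))" for x
  have onto_Q: "(\<Sum>S\<in>Pow \<Lambda>. F S) = (\<Sum>r\<in>Q. F (T r))"
    if "\<And>S. S \<notin> T ` Q \<Longrightarrow> F S = 0" for F :: "(bit ^ 'n) set \<Rightarrow> real"
  proof -
    have "(\<Sum>S\<in>Pow \<Lambda>. F S) = (\<Sum>S\<in>T ` Q. F S)"
      using T(1) that by (intro sum.mono_neutral_right) auto
    then show ?thesis by (simp add: sum.reindex [OF inj])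
  qed
  have aT: "a (T r) = c r" if "r \<in> Q" for r
    using that T(3) by (simp add: a_def)
  have f: "f x = (\<Sum>r\<in>Q. c r * walsh x r)" for x
    unfolding f_def
    by (subst onto_Q) (auto simp: a_def T(3) simp flip: walsh_sum)
  have "q * (\<alpha> * N) = (\<Sum>r\<in>Q. \<alpha> * N)"
    by (simp add: q_def)
  also have "\<dots> \<le> (\<Sum>r\<in>Q. c r * (\<Sum>x\<in>A. walsh x r))"
  proof (rule sum_mono)
    fix r assume "r \<in> Q"
    then have "\<alpha> * N \<le> \<bar>\<Sum>x\<in>A. walsh x r\<bar>"
      by (simp add: Q_def spectrum_def cmod_fourier_indicator N_def)
    then show "\<alpha> * N \<le> c r * (\<Sum>x\<in>A. walsh x r)"
      by (simp add: c_def abs_sgn mult.commute)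
  qed
  also have "\<dots> = (\<Sum>x\<in>A. f x)"
    unfolding f sum_distrib_left by (rule sum.swap)
  finally have large: "q * (\<alpha> * N) \<le> (\<Sum>x\<in>A. f x)" .
  \<comment> \<open>The exponent is even, so extending the sum to the whole group can only increase
    it.\<close>
  have "(\<Sum>x\<in>A. f x ^ (2 * m)) \<le> (\<Sum>x\<in>UNIV. f x ^ (2 * m))"
    by (intro sum_mono2) (auto simp: power_mult)
  also have "\<dots> \<le> N * (\<Sum>S\<in>Pow \<Lambda>. real (2 * m) ^ card S * (a S)\<^sup>2) ^ m"
    unfolding f_def cardU [symmetric]
  proof (rule dissociated_even_moment [OF _ m, where d = d])
    fix S assume S: "S \<subseteq> \<Lambda>"
    show "a S = 0" if "d < card S"
      using that T(2) by (auto simp: a_def)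
    show "(\<Sum>x\<in>UNIV. \<Prod>s\<in>S. walsh x s) = 0" if "S \<noteq> {}" "card S \<le> 2 * m * d"
    proof -
      have "real (card S) \<le> real (2 * m * d)"
        using that(2) by (simp only: of_nat_le_iff)
      with Lambda_family_sum_neq_0 [OF \<Lambda> S that(1)] show ?thesis
        unfolding walsh_sum [symmetric] by (intro sum_walsh_eq_0)
    qed
  qed (simp_all add: walsh_square)
  \<comment> \<open>Only the |Q| sets \<open>T r\<close> contribute, each with weight (2m)^d and
    squared coefficient at most 1.\<close>
  also have "\<dots> \<le> N * (q * real (2 * m) ^ d) ^ m"
  proof (intro mult_left_mono power_mono)
    have "(\<Sum>S\<in>Pow \<Lambda>. real (2 * m) ^ card S * (a S)\<^sup>2) = (\<Sum>r\<in>Q. real (2 * m) ^ d * (c r)\<^sup>2)"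
      by (subst onto_Q) (auto simp: a_def T)
    also have "\<dots> \<le> (\<Sum>r\<in>Q. real (2 * m) ^ d * 1)"
      by (intro sum_mono mult_left_mono) (auto simp: c_def sgn_if)
    finally show "(\<Sum>S\<in>Pow \<Lambda>. real (2 * m) ^ card S * (a S)\<^sup>2) \<le> q * real (2 * m) ^ d"
      by (simp add: q_def)
  qed (use N in \<open>auto intro!: sum_nonneg\<close>)
  finally have moment: "(\<Sum>x\<in>A. f x ^ (2 * m)) \<le> N * (q * real (2 * m) ^ d) ^ m" .
  have card_A': "real (card A) = \<delta> * N" "A \<noteq> {}"
    using card_A \<delta> N unfolding N_def by auto
  have "\<delta> * N * (q * (\<alpha> * N)) ^ (2 * m) \<le> card A * (\<Sum>x\<in>A. f x) ^ (2 * m)"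
    using large q \<alpha> \<delta> N unfolding card_A' by (intro mult_left_mono power_mono) auto
  also have "\<dots> \<le> (\<delta> * N) ^ (2 * m) * (\<Sum>x\<in>A. f x ^ (2 * m))"
    using power_mean_even [of A f m] card_A' by (simp add: finite)
  also have "\<dots> \<le> (\<delta> * N) ^ (2 * m) * (N * (q * real (2 * m) ^ d) ^ m)"
    using moment by (rule mult_left_mono) (simp add: power_mult)
  finally have main: "\<delta> * N * (q * (\<alpha> * N)) ^ (2 * m)
      \<le> (\<delta> * N) ^ (2 * m) * (N * (q * real (2 * m) ^ d) ^ m)" .
  \<comment> \<open>The common positive factor: both sides of \<open>main\<close> are K times the
    corresponding sides of the claim.\<close>
  define K where "K = N * N ^ (2 * m) * q ^ m * \<alpha> ^ (2 * m)"
  have "K > 0" using N q \<alpha> by (simp add: K_def)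
  have "K * (\<delta> * q ^ m) = \<delta> * N * (q * (\<alpha> * N)) ^ (2 * m)"
    by (simp add: K_def power_mult_distrib mult_2 power_add)
  also note main
  also have "(\<delta> * N) ^ (2 * m) * (N * (q * real (2 * m) ^ d) ^ m)
      = K * ((\<delta> / \<alpha>)\<^sup>2 * real (2 * m) ^ d) ^ m"
    using \<alpha> by (simp add: K_def power_mult_distrib power_divide power_mult [symmetric])
  finally show ?thesis
    using \<open>K > 0\<close> unfolding q_def by (simp only: mult_le_cancel_left_pos)
qed

theorem theorem12:
  fixes \<delta> \<alpha> :: real and A \<Lambda> :: "(bit ^ 'n) set" and d :: nat
  assumes "0 < \<alpha>" and "\<alpha> \<le> \<delta>" and "\<delta> \<le> 1 / 4"
    and "real (card A) = \<delta> * 2 ^ CARD('n)"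
    and "\<Lambda> \<in> Lambda_family (2 * log 2 (1 / \<delta>))"
    and "1 \<le> d" and "real d \<le> log 2 (1 / \<delta>) / 4"
  shows "real (card (distinct_sums d \<Lambda> \<inter> spectrum A \<alpha>))
    \<le> (\<delta> / \<alpha>)\<^sup>2 * (2 ^ 12 * log 2 (1 / \<delta>) / real d) ^ d"
proof -
  define l where "l = log 2 (1 / \<delta>)"
  \<comment> \<open>The largest m with 2md \<le> 2l, so that every relation arising in the 2m-th
    moment is short enough to be excluded. Since d \<le> l/4, it is positive.\<close>
  define m where "m = nat \<lfloor>l / d\<rfloor>"
  define q where "q = card (distinct_sums d \<Lambda> \<inter> spectrum A \<alpha>)"
  have \<delta>: "\<delta> > 0" using assms by linarith
  have "4 \<le> l / d" using assms(6,7) by (simp add: l_def field_simps)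
  then have m: "real m \<le> l / d" "l / d < real m + 1" "m > 0"
    unfolding m_def by linarith+
  have md: "real (m * d) \<le> l" "l \<le> real (2 * m * d)"
  proof -
    show "real (m * d) \<le> l"
      using m(1) assms(6) by (simp add: field_simps)
    have "l / d \<le> 2 * real m"
      using m(2,3) by linarith
    then show "l \<le> real (2 * m * d)"
      using assms(6) by (simp add: field_simps)
  qed
  have "Lambda_family (2 * l) \<subseteq> Lambda_family (real (2 * m * d))"
    using md(1) by (force simp: Lambda_family_def)
  then have bound: "\<delta> * real q ^ m \<le> ((\<delta> / \<alpha>)\<^sup>2 * real (2 * m) ^ d) ^ m"
    unfolding q_def using assms \<delta> m(3)
    by (intro card_distinct_sums_spectrum_power_le) (auto simp: l_def)
  \<comment> \<open>Since m is at least half of l/d, the loss \<delta>^(-1/m) is at most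
    4^d.\<close>
  have "1 / \<delta> = 2 powr l"
    using \<delta> by (simp add: l_def)
  also have "\<dots> \<le> 2 powr real (2 * m * d)"
    using md(2) by (intro powr_mono) auto
  also have "\<dots> = (4 ^ d) ^ m"
  proof -
    have "(4 ^ d) ^ m = ((2\<^sup>2 ^ d) ^ m :: real)"
      by simp
    also have "\<dots> = 2 ^ (2 * m * d)"
      unfolding power_mult [symmetric] by (simp only: ac_simps)
    finally show ?thesis
      using powr_realpow [of 2 "2 * m * d"] by simp
  qed
  finally have inv_\<delta>: "1 / \<delta> \<le> (4 ^ d) ^ m" .
  have "real q ^ m = (1 / \<delta>) * (\<delta> * real q ^ m)"
    using \<delta> by simp
  also have "\<dots> \<le> (4 ^ d) ^ m * ((\<delta> / \<alpha>)\<^sup>2 * real (2 * m) ^ d) ^ m"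
    using inv_\<delta> bound \<delta> by (intro mult_mono) auto
  also have "\<dots> = ((\<delta> / \<alpha>)\<^sup>2 * (8 * real m) ^ d) ^ m"
  proof -
    have "4 * real (2 * m) = 8 * real m"
      by simp
    then have "4 ^ d * ((\<delta> / \<alpha>)\<^sup>2 * real (2 * m) ^ d) = (\<delta> / \<alpha>)\<^sup>2 * (8 * real m) ^ d"
      by (metis mult.left_commute power_mult_distrib)
    then show ?thesis
      by (metis power_mult_distrib)
  qed
  finally have "real q \<le> (\<delta> / \<alpha>)\<^sup>2 * (8 * real m) ^ d"
    using m(3) by (simp add: power_mono_iff)
  \<comment> \<open>From m \<le> l/d the argument yields the constant 8 = 4 * 2, which is below
    2^12.\<close>
  also have "\<dots> \<le> (\<delta> / \<alpha>)\<^sup>2 * (2 ^ 12 * l / d) ^ d"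
    using m by (intro mult_left_mono power_mono) auto
  finally show ?thesis
    unfolding q_def l_def .
qed

end
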